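(* Let $U\in\mathbb{R}^{n\times n}$. (a) Let $\rho\ge 0$ and $\mathcal{Z}=\{\Delta\in\mathbb{R}^{n\times n}:\ \|\Delta\|\le\rho\}$, where $\|\cdot\|$ is a general matrix norm. Then $\delta^*_{\mathcal{Z}}(U)=\rho\|U\|^*$. (b) Let $\mathcal{Z}=\{\Delta:\ \Delta^l\preceq\Delta\preceq\Delta^u\}$, where $\Delta^l,\Delta^u$ are given symmetric $n\times n$ matrices such that $\Delta^u-\Delta^l\succ 0_{n\times n}$. Then $$\delta^*_{\mathcal{Z}}(U)=\min_{\Lambda_1,\Lambda_2}\left\{\mathrm{trace}(\Delta^u\Lambda_2)-\mathrm{trace}(\Delta^l\Lambda_1):\ \Lambda_2-\Lambda_1=\frac{U+U^T}{2},\ \Lambda_1,\Lambda_2\succeq 0_{n\times n}\right\}.$$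
   Context: Support function: for a convex set $\mathcal{Z}\subseteq\mathbb{R}^{n\times n}$, $\delta^*_{\mathcal{Z}}(U):=\sup_{\Delta\in\mathcal{Z}}\mathrm{trace}(\Delta U^T)$. Dual norm of a matrix norm $\|\cdot\|$ (any norm on the vector space $\mathbb{R}^{n\times n}$): $\|A\|^*=\max_{\|B\|=1}\mathrm{trace}(B^TA)$. $M\succeq N$ (resp. $M\succ N$) means that $M-N$ is symmetric positive semi-definite (resp. symmetric positive definite); in particular the elements of $\mathcal{Z}$ in (b) are symmetric. *)

theory Defs
  imports "HOL-Analysis.Analysis"
begin

definition matrix_norm :: "(real^'n^'n \<Rightarrow> real) \<Rightarrow> bool" where
  "matrix_norm N \<longleftrightarrow>
     (\<forall>A. 0 \<le> N A) \<and> (\<forall>A. N A = 0 \<longleftrightarrow> A = 0) \<and>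
     (\<forall>c A. N (c *\<^sub>R A) = \<bar>c\<bar> * N A) \<and> (\<forall>A B. N (A + B) \<le> N A + N B)"

text \<open>The maximum is \<^const>\<open>Greatest\<close>; it is attained whenever \<open>N\<close> is a norm, see
  \<open>dual_norm_max\<close> below.\<close>

definition dual_norm :: "(real^'n^'n \<Rightarrow> real) \<Rightarrow> real^'n^'n \<Rightarrow> real" where
  "dual_norm N A = (GREATEST t. \<exists>B. N B = 1 \<and> t = trace (transpose B ** A))"

text \<open>Extended real values, so that the supremum is meaningful for unbounded sets as well.\<close>

definition support_function :: "(real^'n^'n) set \<Rightarrow> real^'n^'n \<Rightarrow> ereal" where
  "support_function Z U = (SUP D\<in>Z. ereal (trace (D ** transpose U)))"

definition psd :: "real^'n^'n \<Rightarrow> bool" where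
  "psd A \<longleftrightarrow> transpose A = A \<and> (\<forall>x. 0 \<le> x \<bullet> (A *v x))"

definition pd :: "real^'n^'n \<Rightarrow> bool" where
  "pd A \<longleftrightarrow> transpose A = A \<and> (\<forall>x. x \<noteq> 0 \<longrightarrow> 0 < x \<bullet> (A *v x))"

definition loewner_le :: "real^'n^'n \<Rightarrow> real^'n^'n \<Rightarrow> bool" (infix "\<preceq>\<^sub>L" 50) where
  "A \<preceq>\<^sub>L B \<longleftrightarrow> psd (B - A)"

definition loewner_less :: "real^'n^'n \<Rightarrow> real^'n^'n \<Rightarrow> bool" (infix "\<prec>\<^sub>L" 50) where
  "A \<prec>\<^sub>L B \<longleftrightarrow> pd (B - A)"

lemma matrix_norm_lipschitz:
  fixes N :: "real^'n^'n \<Rightarrow> real"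
  assumes N: "matrix_norm N"
  obtains C where "0 \<le> C" and "\<And>A B. \<bar>N A - N B\<bar> \<le> C * norm (A - B)"
proof
  have scale: "N (c *\<^sub>R A) = \<bar>c\<bar> * N A" and tri: "N (A + B) \<le> N A + N B"
    and nn: "0 \<le> N A" and zero: "N 0 = 0" for c A B
    using N unfolding matrix_norm_def by auto
  let ?C = "\<Sum>b\<in>Basis. N b"
  show "0 \<le> ?C" by (simp add: nn sum_nonneg)
  have bound: "N A \<le> ?C * norm A" for A
  proof -
    have sum_le: "N (\<Sum>b\<in>S. f b) \<le> (\<Sum>b\<in>S. N (f b))" if "finite S"
      for S and f :: "real^'n^'n \<Rightarrow> real^'n^'n"
      using that
    proof induction
      case (insert x F)
      then show ?case using tri[of "f x" "sum f F"] by simp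
    qed (simp add: zero)
    have "N A = N (\<Sum>b\<in>Basis. (A \<bullet> b) *\<^sub>R b)" by (simp add: euclidean_representation)
    also have "\<dots> \<le> (\<Sum>b\<in>Basis. N ((A \<bullet> b) *\<^sub>R b))" by (rule sum_le) simp
    also have "\<dots> \<le> (\<Sum>b\<in>Basis. norm A * N b)"
      by (rule sum_mono) (simp add: scale nn Basis_le_norm mult_right_mono)
    finally show ?thesis by (simp add: sum_distrib_left mult.commute)
  qed
  show "\<bar>N A - N B\<bar> \<le> ?C * norm (A - B)" for A B
  proof -
    have "N (B - A) = N (A - B)" using scale[of "-1" "A - B"] by simp
    then show ?thesis
      using tri[of "A - B" B] tri[of "B - A" A] bound[of "A - B"] by simp
  qed
qed

lemma dual_norm_max:
  fixes N :: "real^'n^'n \<Rightarrow> real"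
  assumes N: "matrix_norm N"
  shows "\<exists>B. N B = 1 \<and> dual_norm N A = trace (transpose B ** A)"
    and "N B = 1 \<Longrightarrow> trace (transpose B ** A) \<le> dual_norm N A"
proof -
  have scale: "N (c *\<^sub>R A) = \<bar>c\<bar> * N A"
    and nn: "0 \<le> N A" and zero: "N A = 0 \<longleftrightarrow> A = 0" for c A
    using N unfolding matrix_norm_def by auto
  obtain C where "0 \<le> C" and C: "\<And>A B. \<bar>N A - N B\<bar> \<le> C * norm (A - B)"
    using matrix_norm_lipschitz[OF N] by blast
  have cont: "continuous_on S N" for S
    by (rule lipschitz_on_continuous_on[where L=C], rule lipschitz_onI)
      (use \<open>0 \<le> C\<close> C in \<open>auto simp: dist_norm\<close>)
  have tr: "trace (transpose B ** A) = B \<bullet> A" for B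
    unfolding trace_def matrix_matrix_mult_def transpose_def inner_vec_def
    by simp (rule sum.swap)
  have "sphere (0::real^'n^'n) 1 \<noteq> {}" by simp
  then obtain X where X: "X \<in> sphere 0 1" "\<And>Y. Y \<in> sphere 0 1 \<Longrightarrow> N X \<le> N Y"
    using continuous_attains_inf[OF compact_sphere _ cont] by metis
  have "X \<noteq> 0" using X(1) by auto
  then have pos: "0 < N X" using nn[of X] zero[of X] by linarith
  have low: "N X * norm Y \<le> N Y" for Y
  proof (cases "Y = 0")
    case False
    then have "N X \<le> N ((1 / norm Y) *\<^sub>R Y)" by (intro X(2)) simp
    with False show ?thesis by (simp add: scale field_simps)
  qed (simp add: nn)
  have "closed {B. N B = 1}"
    using continuous_closed_preimage[OF cont[of UNIV], of "{1}"] by (simp add: vimage_def)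
  moreover have "bounded {B. N B = 1}"
    by (rule boundedI[where B="1 / N X"])
      (use low pos in \<open>auto simp: field_simps\<close>, metis)
  ultimately have "compact {B. N B = 1}" by (simp add: compact_eq_bounded_closed)
  moreover have "(1 / N X) *\<^sub>R X \<in> {B. N B = 1}" using pos by (simp add: scale)
  moreover have "continuous_on {B. N B = 1} (\<lambda>B. B \<bullet> A)" by (intro continuous_intros)
  ultimately obtain M where M: "N M = 1" "\<And>B. N B = 1 \<Longrightarrow> B \<bullet> A \<le> M \<bullet> A"
    using continuous_attains_sup[of "{B. N B = 1}" "\<lambda>B. B \<bullet> A"]
    by blast
  have dn: "dual_norm N A = M \<bullet> A"
    unfolding dual_norm_def tr by (rule Greatest_equality) (use M in auto)
  show "\<exists>B. N B = 1 \<and> dual_norm N A = trace (transpose B ** A)"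
    using M(1) dn tr by auto
  show "N B = 1 \<Longrightarrow> trace (transpose B ** A) \<le> dual_norm N A"
    using M(2) dn tr by simp
qed

end

theory Submission
  imports Defs
begin

text \<open>
  Part (a) is homogeneity of the trace pairing. For part (b) put \<open>W = Du - Dl\<close> and let \<open>S\<close> be the
  symmetric part of \<open>U\<close>; eliminating \<open>\<Lambda>\<^sub>2 = S + \<Lambda>\<^sub>1\<close>, the right-hand side is
  \<open>\<langle>Du, S\<rangle>\<close> plus the minimum of \<open>\<langle>W, M\<rangle>\<close> over \<open>M \<succeq> 0\<close> with \<open>S + M \<succeq> 0\<close>. The minimum is attained since
  \<open>\<langle>W, M\<rangle> \<ge> c \<parallel>M\<parallel>\<close> on the semidefinite cone. The epigraph of the optimal value as a
  function of \<open>S\<close> is a convex cone; a hyperplane \<open>(Y, 1)\<close> supporting it at the optimum satisfies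
  \<open>0 \<preceq> Y \<preceq> W\<close>, and \<open>Du - Y\<close> is then a primal point with the same value. Everything that is needed
  about the semidefinite cone follows from the fact that it is generated by the matrices \<open>v v\<^sup>T\<close>,
  which is proved by repeatedly subtracting \<open>(A v) (A v)\<^sup>T / (v \<bullet> A v)\<close>.
\<close>

section \<open>The trace inner product\<close>

lemma trace_mult_transpose_eq_inner:
  fixes A B :: "real^'n^'m"
  shows "trace (A ** transpose B) = A \<bullet> B"
  by (simp add: trace_def matrix_matrix_mult_def transpose_def inner_vec_def)

lemma trace_transpose_mult_eq_inner:
  fixes A B :: "real^'n^'m"
  shows "trace (transpose A ** B) = A \<bullet> B"
  unfolding trace_def matrix_matrix_mult_def transpose_def inner_vec_def
  by simp (rule sum.swap)

lemma inner_transpose_transpose: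
  fixes A B :: "real^'n^'m"
  shows "transpose A \<bullet> transpose B = A \<bullet> B"
  unfolding transpose_def inner_vec_def by simp (rule sum.swap)

lemma transpose_add:
  fixes A B :: "'a::plus^'n^'m"
  shows "transpose (A + B) = transpose A + transpose B"
  by (simp add: transpose_def vec_eq_iff)

lemma transpose_diff:
  fixes A B :: "'a::minus^'n^'m"
  shows "transpose (A - B) = transpose A - transpose B"
  by (simp add: transpose_def vec_eq_iff)

text \<open>Transposition preserves the trace pairing, so a symmetric matrix pairs equally with
  \<open>U\<close> and with its transpose. This lets \<open>U\<close> be replaced by its symmetric
  part.\<close>

lemma inner_sym_part:
  fixes A U :: "real^'n^'n"
  assumes "transpose A = A"
  shows "A \<bullet> ((1/2) *\<^sub>R (U + transpose U)) = A \<bullet> U"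
  using inner_transpose_transpose[of A U] assms by (simp add: inner_add_right)

section \<open>The semidefinite cone\<close>

definition outer :: "real^'n \<Rightarrow> real^'n^'n" where
  "outer v = (\<chi> i j. v $ i * v $ j)"

lemma transpose_outer [simp]: "transpose (outer v) = outer v"
  by (simp add: outer_def transpose_def vec_eq_iff mult.commute)

lemma outer_mult_vec: "outer v *v x = (v \<bullet> x) *\<^sub>R v"
  by (simp add: outer_def matrix_vector_mult_def inner_vec_def vec_eq_iff
      sum_distrib_left sum_distrib_right ac_simps)

lemma inner_outer: "B \<bullet> outer v = v \<bullet> (B *v v)"
  by (simp add: outer_def matrix_vector_mult_def inner_vec_def sum_distrib_left ac_simps)

lemma norm_outer: "norm (outer v) = (norm v)\<^sup>2"
proof -
  have "(norm (outer v))\<^sup>2 = ((norm v)\<^sup>2)\<^sup>2"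
    by (simp add: power2_norm_eq_inner inner_outer outer_mult_vec) (simp add: power2_eq_square)
  then show ?thesis by (rule power2_eq_imp_eq) simp_all
qed

lemma psd_outer: "psd (outer v)"
  by (simp add: psd_def outer_mult_vec inner_commute)

lemma psd_zero: "psd 0"
  by (simp add: psd_def transpose_def vec_eq_iff)

lemma psd_add: "psd A \<Longrightarrow> psd B \<Longrightarrow> psd (A + B)"
  by (simp add: psd_def transpose_add matrix_vector_mult_add_rdistrib inner_add_right)

lemma psd_scaleR: "psd A \<Longrightarrow> 0 \<le> c \<Longrightarrow> psd (c *\<^sub>R A)"
  by (simp add: psd_def transpose_scalar scaleR_matrix_vector_assoc[symmetric])

text \<open>The quadratic form becomes a family of inequalities linear in \<open>A\<close>; this
  gives closedness and lets a hyperplane normal be tested on rank-one matrices.\<close>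

lemma psd_iff_inner_outer: "psd A \<longleftrightarrow> transpose A = A \<and> (\<forall>v. 0 \<le> A \<bullet> outer v)"
  by (simp add: psd_def inner_outer)

lemma closed_psd: "closed {A :: real^'n^'n. psd A}"
proof -
  have "closed {A :: real^'n^'n. transpose A = A}"
    unfolding transpose_def vec_eq_iff
    by (intro closed_Collect_all closed_Collect_eq)
      (simp_all add: continuous_intros)
  moreover have "closed {A :: real^'n^'n. \<forall>v. 0 \<le> A \<bullet> outer v}"
    by (intro closed_Collect_all closed_Collect_le continuous_intros)
  ultimately show ?thesis
    unfolding psd_iff_inner_outer by (rule closed_Collect_conj)
qed

lemma inner_mult_vec_commute:
  fixes A :: "real^'n^'n"
  assumes "transpose A = A"
  shows "x \<bullet> (A *v y) = y \<bullet> (A *v x)"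
proof -
  have "x \<bullet> (A *v y) = (transpose A *v x) \<bullet> y"
    by (simp add: dot_lmul_matrix transpose_matrix_vector)
  then show ?thesis by (simp add: assms inner_commute)
qed

lemma psd_Cauchy_Schwarz:
  fixes A :: "real^'n^'n"
  assumes A: "psd A"
  shows "(x \<bullet> (A *v y))\<^sup>2 \<le> (x \<bullet> (A *v x)) * (y \<bullet> (A *v y))"
proof -
  have quad: "0 \<le> x \<bullet> (A *v x) * s\<^sup>2 + 2 * (x \<bullet> (A *v y)) * (s * t) + y \<bullet> (A *v y) * t\<^sup>2" for s t
  proof -
    have "0 \<le> (s *\<^sub>R x + t *\<^sub>R y) \<bullet> (A *v (s *\<^sub>R x + t *\<^sub>R y))"
      using A by (simp add: psd_def)
    also have "\<dots> = x \<bullet> (A *v x) * s\<^sup>2 + 2 * (x \<bullet> (A *v y)) * (s * t) + y \<bullet> (A *v y) * t\<^sup>2"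
      using A inner_mult_vec_commute[of A y x]
      by (simp add: psd_def matrix_vector_right_distrib matrix_vector_mult_scaleR
          inner_add_left inner_add_right power2_eq_square algebra_simps)
    finally show ?thesis .
  qed
  define a b c where "a = x \<bullet> (A *v x)" "b = x \<bullet> (A *v y)" "c = y \<bullet> (A *v y)"
  have "0 \<le> a" "0 \<le> c" using A by (auto simp: psd_def a_b_c_def)
  have q: "0 \<le> a * s\<^sup>2 + 2 * b * (s * t) + c * t\<^sup>2" for s t
    using quad a_b_c_def by simp
  have "b\<^sup>2 \<le> a * c"
  proof (cases "c = 0")
    case True
    show ?thesis
    proof (cases "b = 0")
      case False
      \<comment> \<open>With \<open>c = 0\<close> the form at \<open>s = 1\<close> is affine in
        \<open>t\<close>; this \<open>t\<close> gives it the value \<open>- a - 2\<close>, which is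
        negative.\<close>
      have "0 \<le> a * 1\<^sup>2 + 2 * b * (1 * (- (a + 1) / b)) + c * (- (a + 1) / b)\<^sup>2" by (rule q)
      with False True \<open>0 \<le> a\<close> show ?thesis by simp
    qed (use True in simp)
  next
    case False
    with \<open>0 \<le> c\<close> have "0 < c" by simp
    \<comment> \<open>The choice \<open>s = c\<close>, \<open>t = - b\<close> minimises the form in
      \<open>t\<close> for that \<open>s\<close>.\<close>
    have "0 \<le> a * c\<^sup>2 + 2 * b * (c * (- b)) + c * (- b)\<^sup>2" by (rule q)
    then have "0 \<le> c * (a * c - b\<^sup>2)" by (simp add: power2_eq_square algebra_simps)
    with \<open>0 < c\<close> show ?thesis by (simp add: zero_le_mult_iff)
  qed
  then show ?thesis by (simp add: a_b_c_def)
qed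

text \<open>A vanishing form is semidefinite, so Cauchy-Schwarz kills the mixed terms as
  well.\<close>

lemma symmetric_eq_0_if_quadratic_form_0:
  fixes A :: "real^'n^'n"
  assumes A: "transpose A = A" and 0: "\<And>x. x \<bullet> (A *v x) = 0"
  shows "A = 0"
proof -
  have "psd A" using A 0 by (simp add: psd_def)
  then have "x \<bullet> (A *v y) = 0" for x y
    using psd_Cauchy_Schwarz[of A x y] 0 by simp
  then have "A *v y = 0" for y using inner_eq_zero_iff by blast
  then show ?thesis by (simp add: matrix_eq)
qed

text \<open>Subtracting the rank-one matrix \<open>(A v) (A v)\<^sup>T / (v \<bullet> A v)\<close> enlarges the kernel by \<open>v\<close>.\<close>

lemma psd_rank_one_reduction:
  fixes A :: "real^'n^'n"
  assumes A: "psd A" and "A \<noteq> 0"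
  obtains w where "psd (A - outer w)"
    and "dim {x. A *v x = 0} < dim {x. (A - outer w) *v x = 0}"
proof -
  have sym: "transpose A = A" and nn: "0 \<le> x \<bullet> (A *v x)" for x
    using A by (auto simp: psd_def)
  obtain v where "v \<bullet> (A *v v) \<noteq> 0"
    using symmetric_eq_0_if_quadratic_form_0[OF sym] \<open>A \<noteq> 0\<close> by blast
  with nn[of v] have q: "0 < v \<bullet> (A *v v)" by simp
  define w where "w = (1 / sqrt (v \<bullet> (A *v v))) *\<^sub>R (A *v v)"
  have ow: "outer w *v x = ((x \<bullet> (A *v v)) / (v \<bullet> (A *v v))) *\<^sub>R (A *v v)" for x
    using q by (simp add: outer_mult_vec w_def inner_commute real_sqrt_mult_self flip: real_sqrt_mult)
  have "x \<bullet> ((A - outer w) *v x) = x \<bullet> (A *v x) - (x \<bullet> (A *v v))\<^sup>2 / (v \<bullet> (A *v v))" for x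
    by (simp add: matrix_vector_mult_diff_rdistrib ow inner_diff_right power2_eq_square)
  moreover have "(x \<bullet> (A *v v))\<^sup>2 / (v \<bullet> (A *v v)) \<le> x \<bullet> (A *v x)" for x
    using psd_Cauchy_Schwarz[OF A, of x v] q by (simp add: pos_divide_le_eq)
  ultimately have "0 \<le> x \<bullet> ((A - outer w) *v x)" for x by simp
  then have psd: "psd (A - outer w)"
    by (simp add: psd_def transpose_diff sym)
  have sub: "subspace {x. B *v x = 0}" for B :: "real^'n^'n"
    by (auto simp: subspace_def matrix_vector_right_distrib matrix_vector_mult_scaleR)
  \<comment> \<open>The old kernel survives because
    \<open>x \<bullet> (A *v v) = v \<bullet> (A *v x) = 0\<close> there; \<open>v\<close> is a new
    kernel vector.\<close>
  have "(A - outer w) *v x = 0" if "A *v x = 0" for x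
    using that inner_mult_vec_commute[OF sym, of x v]
    by (simp add: matrix_vector_mult_diff_rdistrib ow)
  moreover have "(A - outer w) *v v = 0" "A *v v \<noteq> 0"
    using q by (auto simp: matrix_vector_mult_diff_rdistrib ow)
  ultimately have "{x. A *v x = 0} \<subset> {x. (A - outer w) *v x = 0}" by blast
  then have "dim {x. A *v x = 0} < dim {x. (A - outer w) *v x = 0}"
    by (intro dim_psubset) (simp add: sub span_eq_iff[THEN iffD2])
  with psd show ?thesis by (rule that)
qed

text \<open>Induction on the rank, written as the codimension of the kernel: each rank-one reduction
  lowers it.\<close>

lemma psd_induct [consumes 1, case_names zero add_outer]:
  fixes A :: "real^'n^'n"
  assumes "psd A"
    and zero: "P 0"
    and step: "\<And>B v. psd B \<Longrightarrow> P B \<Longrightarrow> P (B + outer v)"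
  shows "P A"
  using \<open>psd A\<close>
proof (induction "CARD('n) - dim {x. A *v x = 0}" arbitrary: A rule: less_induct)
  case less
  show ?case
  proof (cases "A = 0")
    case False
    then obtain w where w: "psd (A - outer w)"
      "dim {x. A *v x = 0} < dim {x. (A - outer w) *v x = 0}"
      using psd_rank_one_reduction less.prems by blast
    \<comment> \<open>This bound makes the truncated difference of naturals strictly
      decrease.\<close>
    have "dim {x. (A - outer w) *v x = 0} \<le> CARD('n)"
      using dim_subset_UNIV[of "{x. (A - outer w) *v x = 0}"] by simp
    with w have "P (A - outer w)" by (intro less.hyps) auto
    from step[OF w(1) this, of w] show ?thesis by simp
  qed (simp add: zero)
qed

text \<open>Each rank-one summand of \<open>A\<close> contributes a value of the quadratic form of
  \<open>B\<close>.\<close>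

lemma psd_inner_nonneg:
  assumes "psd A" "psd B"
  shows "0 \<le> B \<bullet> A"
  using assms(1)
proof (induction A rule: psd_induct)
  case (add_outer A v)
  with assms(2) show ?case by (simp add: psd_def inner_outer inner_add_right)
qed simp

text \<open>The constant is the minimum of the form of \<open>W\<close> on the unit sphere. It works
  for rank-one matrices, where \<open>norm (outer v)\<close> is the squared length of
  \<open>v\<close>, and the triangle inequality carries it to their sums.\<close>

lemma pd_inner_coercive:
  fixes W :: "real^'n^'n"
  assumes "pd W"
  obtains c where "0 < c" and "\<And>M. psd M \<Longrightarrow> c * norm M \<le> W \<bullet> M"
proof -
  have "sphere (0::real^'n) 1 \<noteq> {}" by simp
  moreover have "continuous_on (sphere 0 1) (\<lambda>x. x \<bullet> (W *v x))"
    by (intro continuous_intros matrix_vector_mult_linear_continuous_on)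
  ultimately obtain u where u: "u \<in> sphere 0 1"
    "\<And>x. x \<in> sphere 0 1 \<Longrightarrow> u \<bullet> (W *v u) \<le> x \<bullet> (W *v x)"
    using continuous_attains_inf[OF compact_sphere, of 0 1 "\<lambda>x. x \<bullet> (W *v x)"] by blast
  define c where "c = u \<bullet> (W *v u)"
  have "u \<noteq> 0" using u(1) by auto
  then have "0 < c" using assms by (simp add: pd_def c_def)
  have low: "c * (norm x)\<^sup>2 \<le> x \<bullet> (W *v x)" for x
  proof (cases "x = 0")
    case False
    then have "c \<le> ((1 / norm x) *\<^sub>R x) \<bullet> (W *v ((1 / norm x) *\<^sub>R x))"
      unfolding c_def by (intro u(2)) simp
    with False show ?thesis
      by (simp add: matrix_vector_mult_scaleR power2_eq_square pos_le_divide_eq)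
  qed simp
  have "c * norm M \<le> W \<bullet> M" if "psd M" for M
    using that
  proof (induction M rule: psd_induct)
    case (add_outer B v)
    have "c * norm (B + outer v) \<le> c * norm B + c * (norm v)\<^sup>2"
      using norm_triangle_ineq[of B "outer v"] \<open>0 < c\<close>
      by (simp add: norm_outer flip: distrib_left)
    with add_outer low[of v] show ?case by (simp add: inner_add_right inner_outer)
  qed simp
  with \<open>0 < c\<close> show ?thesis by (rule that)
qed

section \<open>Semidefinite duality on an operator interval\<close>

lemma psd_shift_feasible:
  fixes S :: "real^'n^'n"
  assumes "transpose S = S"
  obtains M where "psd M" "psd (S + M)"
proof
  \<comment> \<open>The Frobenius norm bounds the form of \<open>S\<close> on unit vectors, so this
    multiple of the identity compensates its negative part.\<close>
  let ?M = "norm S *\<^sub>R mat 1 :: real^'n^'n"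
  have sym: "transpose ?M = ?M" by (simp add: transpose_scalar)
  show "psd ?M"
    unfolding psd_def using sym by (simp add: scaleR_matrix_vector_assoc[symmetric])
  have "- (x \<bullet> (S *v x)) \<le> norm S * (x \<bullet> x)" for x
    using Cauchy_Schwarz_ineq2[of S "outer x"]
    by (simp add: inner_outer norm_outer power2_norm_eq_inner)
  then show "psd (S + ?M)"
    unfolding psd_def using sym assms
    by (simp add: transpose_add matrix_vector_mult_add_rdistrib inner_add_right
        scaleR_matrix_vector_assoc[symmetric])
      (smt (verit))
qed

lemma psd_shift_min_exists:
  fixes S W :: "real^'n^'n"
  assumes S: "transpose S = S" and W: "pd W"
  obtains L where "psd L" "psd (S + L)"
    and "\<And>M. psd M \<Longrightarrow> psd (S + M) \<Longrightarrow> W \<bullet> L \<le> W \<bullet> M"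
proof -
  obtain c where c: "0 < c" "\<And>M. psd M \<Longrightarrow> c * norm M \<le> W \<bullet> M"
    using pd_inner_coercive[OF W] by blast
  obtain M0 where M0: "psd M0" "psd (S + M0)" using psd_shift_feasible[OF S] by blast
  \<comment> \<open>Cutting at the level of a feasible \<open>M0\<close> keeps all candidates for
    the minimum, and coercivity makes the cut bounded.\<close>
  define F where "F = {M. psd M} \<inter> (\<lambda>M. S + M) -` {M. psd M} \<inter> {M. W \<bullet> M \<le> W \<bullet> M0}"
  have "closed F"
    unfolding F_def
    by (intro closed_Int closed_psd continuous_closed_vimage closed_Collect_le continuous_intros)
  moreover have "norm M \<le> (W \<bullet> M0) / c" if "M \<in> F" for M
    using that c(2)[of M] c(1) by (simp add: F_def field_simps)
  then have "bounded F" by (rule boundedI)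
  ultimately have "compact F" by (simp add: compact_eq_bounded_closed)
  moreover have "M0 \<in> F" using M0 by (simp add: F_def)
  moreover have "continuous_on F (\<lambda>M. W \<bullet> M)" by (intro continuous_intros)
  ultimately obtain L where L: "L \<in> F" "\<And>M. M \<in> F \<Longrightarrow> W \<bullet> L \<le> W \<bullet> M"
    using continuous_attains_inf[of F "\<lambda>M. W \<bullet> M"] by blast
  show ?thesis
  proof
    show "psd L" "psd (S + L)" using L(1) by (auto simp: F_def)
    show "W \<bullet> L \<le> W \<bullet> M" if "psd M" "psd (S + M)" for M
      using that L(2)[of M] L(2)[OF \<open>M0 \<in> F\<close>] by (cases "W \<bullet> M \<le> W \<bullet> M0") (auto simp: F_def)
  qed
qed

text \<open>The symmetrization of \<open>X\<close> makes the epigraph \<open>E\<close> project onto the whole matrix space, which rules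
  out vertical hyperplanes and forces \<open>Y\<close> to be symmetric.\<close>

lemma psd_shift_dual_exists:
  fixes S W :: "real^'n^'n"
  assumes S: "transpose S = S" and W: "transpose W = W"
    and min: "\<And>M. psd M \<Longrightarrow> psd (S + M) \<Longrightarrow> d \<le> W \<bullet> M"
  obtains Y where "psd Y" "psd (W - Y)" "Y \<bullet> S + d \<le> 0"
proof -
  define sy where "sy X = (1/2) *\<^sub>R (X + transpose X)" for X :: "real^'n^'n"
  have sy_sym: "sy X = X" if "transpose X = X" for X
    using that by (simp add: sy_def flip: scaleR_2)
  have tsy: "transpose (sy X) = sy X" for X
    by (simp add: sy_def transpose_scalar transpose_add add.commute)
  have sy_add: "sy (X + X') = sy X + sy X'" for X X'
    by (simp add: sy_def transpose_add scaleR_add_right)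
  have sy_scale: "sy (a *\<^sub>R X) = a *\<^sub>R sy X" for a X
    by (simp add: sy_def transpose_scalar scaleR_add_right)
  define E where "E = {(X, r). \<exists>M. psd M \<and> psd (sy X + M) \<and> W \<bullet> M \<le> r}"
  have E_add: "(X + X', r + r') \<in> E" if "(X, r) \<in> E" "(X', r') \<in> E" for X X' r r'
  proof -
    from that obtain M M' where "psd M" "psd (sy X + M)" "W \<bullet> M \<le> r"
      "psd M'" "psd (sy X' + M')" "W \<bullet> M' \<le> r'" by (auto simp: E_def)
    moreover have "sy (X + X') + (M + M') = (sy X + M) + (sy X' + M')" by (simp add: sy_add)
    ultimately have "psd (M + M')" "psd (sy (X + X') + (M + M'))" "W \<bullet> (M + M') \<le> r + r'"
      using psd_add by (auto simp only: inner_add_right intro: add_mono)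
    then show ?thesis by (auto simp: E_def)
  qed
  have E_scale: "(a *\<^sub>R X, a * r) \<in> E" if "(X, r) \<in> E" "0 \<le> a" for a X r
  proof -
    from that obtain M where "psd M" "psd (sy X + M)" "W \<bullet> M \<le> r" by (auto simp: E_def)
    with \<open>0 \<le> a\<close> have "psd (a *\<^sub>R M)" "psd (a *\<^sub>R (sy X + M))" "W \<bullet> (a *\<^sub>R M) \<le> a * r"
      by (auto intro: psd_scaleR mult_left_mono)
    then show ?thesis by (auto simp: E_def sy_scale scaleR_add_right)
  qed
  have "convex E"
    unfolding convex_def using E_add E_scale by (auto simp: split_paired_all)
  moreover have "convex ({S} \<times> {..<d})" by (intro convex_Times) auto
  moreover have "(0, 0) \<in> E"
    by (auto simp: E_def sy_sym psd_zero transpose_def vec_eq_iff intro!: exI[of _ 0])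
  moreover have "({S} \<times> {..<d}) \<noteq> {}" by (auto intro: lt_ex)
  moreover have "E \<inter> ({S} \<times> {..<d}) = {}"
    using min by (fastforce simp: E_def sy_sym[OF S])
  ultimately obtain a b where a: "a \<noteq> 0" "\<And>p. p \<in> {S} \<times> {..<d} \<Longrightarrow> a \<bullet> p \<le> b"
    "\<And>p. p \<in> E \<Longrightarrow> b \<le> a \<bullet> p"
    using separating_hyperplane_sets[of "{S} \<times> {..<d}" E] by (metis empty_iff inf_commute)
  obtain Z t where Zt: "a = (Z, t)" by (cases a)
  have below: "Z \<bullet> S + t * r \<le> b" if "r < d" for r
    using a(2)[of "(S, r)"] that by (simp add: Zt)
  have above: "b \<le> Z \<bullet> X + t * r" if "(X, r) \<in> E" for X r
    using a(3)[OF that] by (simp add: Zt)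
  have "b \<le> 0" using above[OF \<open>(0, 0) \<in> E\<close>] by simp
  have cone: "0 \<le> Z \<bullet> X + t * r" if "(X, r) \<in> E" for X r
  proof (rule ccontr)
    assume neg: "\<not> ?thesis"
    \<comment> \<open>Scaling by \<open>k\<close> would bring the functional down to
      \<open>b - 1\<close>, below its lower bound \<open>b\<close> on the cone.\<close>
    define k where "k = (b - 1) / (Z \<bullet> X + t * r)"
    have "0 \<le> k" using neg \<open>b \<le> 0\<close> by (simp add: k_def divide_nonpos_neg)
    from above[OF E_scale[OF that this]] have "b \<le> k * (Z \<bullet> X + t * r)"
      by (simp add: algebra_simps)
    also have "\<dots> = b - 1" using neg by (simp add: k_def)
    finally show False by simp
  qed
  have "(0, 1) \<in> E"
    by (auto simp: E_def sy_sym psd_zero transpose_def vec_eq_iff intro!: exI[of _ 0])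
  from cone[OF this] have "0 \<le> t" by simp
  have "t \<noteq> 0"
  proof
    assume "t = 0"
    \<comment> \<open>A vertical hyperplane is refuted at a point of \<open>E\<close> above
      \<open>- Z\<close>.\<close>
    obtain M where "psd M" "psd (sy (- Z) + M)" using psd_shift_feasible[OF tsy] by blast
    then have "(- Z, W \<bullet> M) \<in> E" by (auto simp: E_def)
    from cone[OF this] \<open>t = 0\<close> have "Z \<bullet> Z \<le> 0" by simp
    then have "Z = 0" using inner_gt_zero_iff[of Z] by linarith
    with \<open>t = 0\<close> \<open>a \<noteq> 0\<close> Zt show False by (simp add: zero_prod_def)
  qed
  with \<open>0 \<le> t\<close> have "0 < t" by simp
  define Y where "Y = (1 / t) *\<^sub>R Z"
  have Z: "Z = t *\<^sub>R Y" using \<open>0 < t\<close> by (simp add: Y_def)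
  have Y: "0 \<le> Y \<bullet> X + r" if "(X, r) \<in> E" for X r
    using cone[OF that] \<open>0 < t\<close> by (simp add: Z zero_le_mult_iff flip: distrib_left)
  \<comment> \<open>Antisymmetric matrices lie in \<open>E\<close> at height 0; pairing
    \<open>Y\<close> with this one gives minus half the squared norm of
    \<open>transpose Y - Y\<close>.\<close>
  have "sy (transpose Y - Y) = 0" by (simp add: sy_def transpose_diff)
  then have "(transpose Y - Y, 0) \<in> E"
    by (auto simp: E_def psd_zero intro!: exI[of _ 0])
  from Y[OF this] have "(transpose Y - Y) \<bullet> (transpose Y - Y) \<le> 0"
    using inner_transpose_transpose[of Y Y]
    by (simp add: inner_diff_left inner_diff_right inner_commute)
  then have symY: "transpose Y = Y"
    using inner_gt_zero_iff[of "transpose Y - Y"] by (simp add: not_less[symmetric])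
  show ?thesis
  proof
    \<comment> \<open>The shifts \<open>M = 0\<close> over \<open>outer v\<close> and
      \<open>M = outer v\<close> over \<open>- outer v\<close> yield the two bounds on
      \<open>Y\<close>.\<close>
    have "(outer v, 0) \<in> E" for v
      by (auto simp: E_def sy_sym psd_zero psd_outer intro!: exI[of _ 0])
    from Y[OF this] symY show "psd Y" by (simp add: psd_iff_inner_outer)
    have "(- outer v, W \<bullet> outer v) \<in> E" for v
      using sy_scale[of "-1" "outer v"]
      by (auto simp: E_def sy_sym psd_zero psd_outer intro!: exI[of _ "outer v"])
    from Y[OF this] symY W show "psd (W - Y)"
      by (simp add: psd_iff_inner_outer transpose_diff inner_diff_left)
    have "r \<le> - (Y \<bullet> S)" if "r < d" for r
    proof -
      have "t * (Y \<bullet> S + r) \<le> 0"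
        using below[OF that] \<open>b \<le> 0\<close> by (simp add: Z algebra_simps)
      with \<open>0 < t\<close> show ?thesis by (simp add: mult_le_0_iff)
    qed
    then have "d \<le> - (Y \<bullet> S)" by (rule dense_le)
    then show "Y \<bullet> S + d \<le> 0" by simp
  qed
qed

section \<open>Support functions of norm balls and Loewner intervals\<close>

lemma support_function_eqI:
  assumes "D \<in> Z" "D \<bullet> U = m" "\<And>D'. D' \<in> Z \<Longrightarrow> D' \<bullet> U \<le> m"
  shows "support_function Z U = ereal m"
  unfolding support_function_def trace_mult_transpose_eq_inner
proof (rule antisym)
  show "(SUP D\<in>Z. ereal (D \<bullet> U)) \<le> ereal m" using assms(3) by (intro SUP_least) simp
  show "ereal m \<le> (SUP D\<in>Z. ereal (D \<bullet> U))" using assms(1,2) by (intro SUP_upper2[of D]) auto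
qed

text \<open>The value is attained at \<open>\<rho>\<close> times a unit maximiser of the dual norm;
  any other nonzero point is compared with it after normalisation.\<close>

lemma support_function_norm_ball:
  fixes N :: "real^'n^'n \<Rightarrow> real"
  assumes N: "matrix_norm N" and "0 \<le> \<rho>"
  shows "support_function {D. N D \<le> \<rho>} U = ereal (\<rho> * dual_norm N U)"
proof -
  have scale: "N (c *\<^sub>R A) = \<bar>c\<bar> * N A" and nn: "0 \<le> N A"
    and zero: "N A = 0 \<longleftrightarrow> A = 0" for c A
    using N unfolding matrix_norm_def by auto
  obtain B where B: "N B = 1" "dual_norm N U = B \<bullet> U"
    using dual_norm_max(1)[OF N, of U] by (auto simp: trace_transpose_mult_eq_inner)
  have ub: "C \<bullet> U \<le> dual_norm N U" if "N C = 1" for C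
    using dual_norm_max(2)[OF N that, of U] by (simp add: trace_transpose_mult_eq_inner)
  \<comment> \<open>Both \<open>B\<close> and \<open>- B\<close> are unit matrices, so the maximum
    is nonnegative; this justifies enlarging \<open>N D\<close> to \<open>\<rho>\<close>.\<close>
  have "N (- B) = 1" using scale[of "-1" B] B(1) by simp
  from ub[OF this] B(2) have dn: "0 \<le> dual_norm N U" by simp
  show ?thesis
  proof (rule support_function_eqI)
    show "\<rho> *\<^sub>R B \<in> {D. N D \<le> \<rho>}" using B(1) \<open>0 \<le> \<rho>\<close> by (simp add: scale)
    show "(\<rho> *\<^sub>R B) \<bullet> U = \<rho> * dual_norm N U" using B(2) by simp
    show "D \<bullet> U \<le> \<rho> * dual_norm N U" if "D \<in> {D. N D \<le> \<rho>}" for D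
    proof (cases "D = 0")
      case False
      then have "0 < N D" using nn[of D] zero[of D] by simp
      then have "((1 / N D) *\<^sub>R D) \<bullet> U \<le> dual_norm N U" by (intro ub) (simp add: scale)
      then have "D \<bullet> U \<le> N D * dual_norm N U"
        using \<open>0 < N D\<close> by (simp add: field_simps)
      also have "\<dots> \<le> \<rho> * dual_norm N U" using that dn by (simp add: mult_right_mono)
      finally show ?thesis .
    qed (use dn \<open>0 \<le> \<rho>\<close> in simp)
  qed
qed

lemma support_function_loewner_interval:
  fixes U Dl Du :: "real^'n^'n"
  assumes Dl: "transpose Dl = Dl" and Du: "transpose Du = Du" and W: "0 \<prec>\<^sub>L Du - Dl"
  shows "\<exists>L1 L2.
    is_arg_min (\<lambda>(M1, M2). trace (Du ** M2) - trace (Dl ** M1))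
      (\<lambda>(M1, M2). M2 - M1 = (1/2) *\<^sub>R (U + transpose U) \<and> 0 \<preceq>\<^sub>L M1 \<and> 0 \<preceq>\<^sub>L M2)
      (L1, L2) \<and>
    support_function {D. Dl \<preceq>\<^sub>L D \<and> D \<preceq>\<^sub>L Du} U
      = ereal (trace (Du ** L2) - trace (Dl ** L1))"
proof -
  define S where "S = (1/2) *\<^sub>R (U + transpose U)"
  have S: "transpose S = S"
    by (simp add: S_def transpose_scalar transpose_add add.commute)
  have pdW: "pd (Du - Dl)" using W by (simp add: loewner_less_def)
  have inner_S: "D \<bullet> U = D \<bullet> S" if "transpose D = D" for D
    using inner_sym_part[OF that] by (simp add: S_def)
  have obj: "trace (Du ** (S + M)) - trace (Dl ** M) = Du \<bullet> S + (Du - Dl) \<bullet> M"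
    if "psd M" for M
  proof -
    have "transpose M = M" using that by (simp add: psd_def)
    then have "trace (Du ** (S + M)) = Du \<bullet> (S + M)" "trace (Dl ** M) = Dl \<bullet> M"
      using trace_mult_transpose_eq_inner[of Du "S + M"] trace_mult_transpose_eq_inner[of Dl M]
      by (simp_all add: transpose_add S)
    then show ?thesis by (simp add: inner_add_right inner_diff_left)
  qed
  obtain L where L: "psd L" "psd (S + L)"
    and min: "\<And>M. psd M \<Longrightarrow> psd (S + M) \<Longrightarrow> (Du - Dl) \<bullet> L \<le> (Du - Dl) \<bullet> M"
    using psd_shift_min_exists[OF S pdW] by blast
  \<comment> \<open>Here \<open>d\<close> is the attained minimum
    \<open>(Du - Dl) \<bullet> L\<close>.\<close>
  obtain Y where Y: "psd Y" "psd (Du - Dl - Y)" "Y \<bullet> S + (Du - Dl) \<bullet> L \<le> 0"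
    using psd_shift_dual_exists[OF S _ min] Dl Du by (auto simp: transpose_diff)
  \<comment> \<open>Weak duality: the pairings of \<open>D - Dl\<close> with \<open>L\<close> and of
    \<open>Du - D\<close> with \<open>S + L\<close> add up to the gap.\<close>
  have weak: "D \<bullet> U \<le> Du \<bullet> S + (Du - Dl) \<bullet> L" if "Dl \<preceq>\<^sub>L D" "D \<preceq>\<^sub>L Du" for D
  proof -
    have "psd (D - Dl)" "psd (Du - D)" using that by (auto simp: loewner_le_def)
    then have "0 \<le> (D - Dl) \<bullet> L" "0 \<le> (Du - D) \<bullet> (S + L)"
      using L psd_inner_nonneg by blast+
    moreover have "transpose D = D"
      using \<open>psd (D - Dl)\<close> Dl by (simp add: psd_def transpose_diff)
    ultimately show ?thesis
      by (simp add: inner_S inner_add_right inner_diff_left)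
  qed
  \<comment> \<open>The bounds \<open>0 \<preceq> Y \<preceq> Du - Dl\<close> place
    \<open>Du - Y\<close> in the interval, and \<open>Y(3)\<close> gives it at least the dual
    value.\<close>
  have Z: "Du - Y \<in> {D. Dl \<preceq>\<^sub>L D \<and> D \<preceq>\<^sub>L Du}"
    using Y by (simp add: loewner_le_def algebra_simps)
  have "transpose (Du - Y) = Du - Y"
    using Y(1) Du by (simp add: psd_def transpose_diff)
  then have "Du \<bullet> S + (Du - Dl) \<bullet> L \<le> (Du - Y) \<bullet> U"
    using Y(3) inner_S[of "Du - Y"] by (simp add: inner_diff_left)
  then have "(Du - Y) \<bullet> U = Du \<bullet> S + (Du - Dl) \<bullet> L"
    using weak Z by force
  from support_function_eqI[OF Z this] weak
  have "support_function {D. Dl \<preceq>\<^sub>L D \<and> D \<preceq>\<^sub>L Du} U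
      = ereal (trace (Du ** (S + L)) - trace (Dl ** L))"
    by (simp add: obj L)
  moreover have "is_arg_min (\<lambda>(M1, M2). trace (Du ** M2) - trace (Dl ** M1))
      (\<lambda>(M1, M2). M2 - M1 = S \<and> 0 \<preceq>\<^sub>L M1 \<and> 0 \<preceq>\<^sub>L M2) (L, S + L)"
    using L min by (auto simp: is_arg_min_linorder loewner_le_def obj diff_eq_eq)
  ultimately show ?thesis unfolding S_def by blast
qed

theorem lemma3:
  fixes U :: "real^'n^'n"
  shows "(\<forall>(N :: real^'n^'n \<Rightarrow> real) (\<rho>::real). matrix_norm N \<and> 0 \<le> \<rho> \<longrightarrow>
            support_function {D. N D \<le> \<rho>} U = ereal (\<rho> * dual_norm N U)) \<and>
         (\<forall>(Dl :: real^'n^'n) (Du :: real^'n^'n).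
            transpose Dl = Dl \<and> transpose Du = Du \<and> 0 \<prec>\<^sub>L Du - Dl \<longrightarrow>
            (\<exists>L1 L2.
               is_arg_min (\<lambda>(M1, M2). trace (Du ** M2) - trace (Dl ** M1))
                 (\<lambda>(M1, M2). M2 - M1 = (1/2) *\<^sub>R (U + transpose U) \<and> 0 \<preceq>\<^sub>L M1 \<and> 0 \<preceq>\<^sub>L M2)
                 (L1, L2) \<and>
               support_function {D. Dl \<preceq>\<^sub>L D \<and> D \<preceq>\<^sub>L Du} U
                 = ereal (trace (Du ** L2) - trace (Dl ** L1))))"
  using support_function_norm_ball support_function_loewner_interval by blast

end
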